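(* Suppose that $F : \mathsf C \to \mathsf D$ is a separable functor. Let $f$ be a morphism in $\mathsf C$. (a) If $F(f)$ is a monomorphism, then $f$ is a monomorphism. (b) If $F(f)$ is an epimorphism, then $f$ is an epimorphism.
   Context: Functors are covariant. A functor $F:\mathsf C\to\mathsf D$ is separable if for all objects $M,N$ of $\mathsf C$ there is a function $R_{M,N}:\mathrm{Hom}_{\mathsf D}(F(M),F(N))\to\mathrm{Hom}_{\mathsf C}(M,N)$ such that (SF1) $R_{M,N}(F(h))=h$ for all $h:M\to N$ in $\mathsf C$; and (SF2) for all $h:M\to M'$, $g:N\to N'$ in $\mathsf C$ and $h':F(M)\to F(N)$, $g':F(M')\to F(N')$ in $\mathsf D$, if $F(g)h'=g'F(h)$ then $g\,R_{M,N}(h')=R_{M',N'}(g')\,h$. *)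

theory Defs
  imports Main
begin

text \<open>
  As in HOL-Algebra, structures are records relativised to carriers. Domain and codomain are
  part of an arrow, so hom-sets are automatically disjoint, and \<open>g \<cdot>\<^bsub>C\<^esub> f\<close> means
  ``first \<open>f\<close>, then \<open>g\<close>''; it is only constrained when the codomain of \<open>f\<close> is the domain of \<open>g\<close>.
\<close>

record ('o, 'm) category =
  Obj :: "'o set"
  Arr :: "'m set"
  Dom :: "'m \<Rightarrow> 'o"
  Cod :: "'m \<Rightarrow> 'o"
  Id :: "'o \<Rightarrow> 'm"
  Comp :: "'m \<Rightarrow> 'm \<Rightarrow> 'm"  (infixl "\<cdot>\<index>" 70)

definition Hom :: "('o, 'm, 'x) category_scheme \<Rightarrow> 'o \<Rightarrow> 'o \<Rightarrow> 'm set" where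
  "Hom C A B = {f \<in> Arr C. Dom C f = A \<and> Cod C f = B}"

locale category =
  fixes C :: "('o, 'm, 'x) category_scheme" (structure)
  assumes Dom_closed: "f \<in> Arr C \<Longrightarrow> Dom C f \<in> Obj C"
    and Cod_closed: "f \<in> Arr C \<Longrightarrow> Cod C f \<in> Obj C"
    and Id_closed: "A \<in> Obj C \<Longrightarrow> Id C A \<in> Hom C A A"
    and Comp_closed: "\<lbrakk>f \<in> Hom C A B; g \<in> Hom C B D\<rbrakk> \<Longrightarrow> g \<cdot> f \<in> Hom C A D"
    and Comp_assoc: "\<lbrakk>f \<in> Hom C A B; g \<in> Hom C B D; h \<in> Hom C D E\<rbrakk>
                     \<Longrightarrow> h \<cdot> (g \<cdot> f) = (h \<cdot> g) \<cdot> f"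
    and Id_left: "f \<in> Hom C A B \<Longrightarrow> Id C B \<cdot> f = f"
    and Id_right: "f \<in> Hom C A B \<Longrightarrow> f \<cdot> Id C A = f"

definition monomorphism :: "('o, 'm, 'x) category_scheme \<Rightarrow> 'm \<Rightarrow> bool" where
  "monomorphism C f \<longleftrightarrow> f \<in> Arr C \<and>
     (\<forall>A \<in> Obj C. \<forall>g \<in> Hom C A (Dom C f). \<forall>h \<in> Hom C A (Dom C f).
        f \<cdot>\<^bsub>C\<^esub> g = f \<cdot>\<^bsub>C\<^esub> h \<longrightarrow> g = h)"

definition epimorphism :: "('o, 'm, 'x) category_scheme \<Rightarrow> 'm \<Rightarrow> bool" where
  "epimorphism C f \<longleftrightarrow> f \<in> Arr C \<and>
     (\<forall>A \<in> Obj C. \<forall>g \<in> Hom C (Cod C f) A. \<forall>h \<in> Hom C (Cod C f) A.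
        g \<cdot>\<^bsub>C\<^esub> f = h \<cdot>\<^bsub>C\<^esub> f \<longrightarrow> g = h)"

record ('o, 'm, 'p, 'n) functor_maps =
  omap :: "'o \<Rightarrow> 'p"
  amap :: "'m \<Rightarrow> 'n"

locale covariant_functor = C: category C + D: category D
  for C :: "('o, 'm, 'x) category_scheme" and D :: "('p, 'n, 'y) category_scheme" +
  fixes F :: "('o, 'm, 'p, 'n, 'z) functor_maps_scheme"
  assumes omap_closed: "A \<in> Obj C \<Longrightarrow> omap F A \<in> Obj D"
    and amap_closed: "f \<in> Hom C A B \<Longrightarrow> amap F f \<in> Hom D (omap F A) (omap F B)"
    and amap_Id: "A \<in> Obj C \<Longrightarrow> amap F (Id C A) = Id D (omap F A)"
    and amap_Comp: "\<lbrakk>f \<in> Hom C A B; g \<in> Hom C B E\<rbrakk>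
                    \<Longrightarrow> amap F (g \<cdot>\<^bsub>C\<^esub> f) = amap F g \<cdot>\<^bsub>D\<^esub> amap F f"

definition separating_maps ::
  "('o, 'm, 'x) category_scheme \<Rightarrow> ('p, 'n, 'y) category_scheme \<Rightarrow>
   ('o, 'm, 'p, 'n, 'z) functor_maps_scheme \<Rightarrow> ('o \<Rightarrow> 'o \<Rightarrow> 'n \<Rightarrow> 'm) \<Rightarrow> bool" where
  "separating_maps C D F R \<longleftrightarrow>
     (\<forall>M \<in> Obj C. \<forall>N \<in> Obj C. \<forall>h' \<in> Hom D (omap F M) (omap F N). R M N h' \<in> Hom C M N) \<and>
     (\<forall>M \<in> Obj C. \<forall>N \<in> Obj C. \<forall>h \<in> Hom C M N. R M N (amap F h) = h) \<and>
     (\<forall>M \<in> Obj C. \<forall>M' \<in> Obj C. \<forall>N \<in> Obj C. \<forall>N' \<in> Obj C.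
        \<forall>h \<in> Hom C M M'. \<forall>g \<in> Hom C N N'.
        \<forall>h' \<in> Hom D (omap F M) (omap F N). \<forall>g' \<in> Hom D (omap F M') (omap F N').
          amap F g \<cdot>\<^bsub>D\<^esub> h' = g' \<cdot>\<^bsub>D\<^esub> amap F h \<longrightarrow>
          g \<cdot>\<^bsub>C\<^esub> R M N h' = R M' N' g' \<cdot>\<^bsub>C\<^esub> h)"

locale separable_functor = covariant_functor C D F
  for C :: "('o, 'm, 'x) category_scheme" and D :: "('p, 'n, 'y) category_scheme"
    and F :: "('o, 'm, 'p, 'n, 'z) functor_maps_scheme" +
  assumes separable: "\<exists>R. separating_maps C D F R"

end

theory Submission
  imports Defs
begin

text \<open>
  By (SF1) the maps \<open>R M N\<close> are retractions of the action of \<open>F\<close> on hom-sets, so a separable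
  functor is faithful (\<open>separable_functor.faithful\<close>). A faithful functor reflects monomorphisms:
  \<open>f \<cdot> g = f \<cdot> h\<close> gives \<open>F(f) \<cdot> F(g) = F(f) \<cdot> F(h)\<close>, then \<open>F(f)\<close> is cancelled to get
  \<open>F(g) = F(h)\<close>, and faithfulness removes \<open>F\<close>. Epimorphisms are reflected by the same argument
  with cancellation on the other side.
\<close>

definition faithful ::
  "('o, 'm, 'x) category_scheme \<Rightarrow> ('o, 'm, 'p, 'n, 'z) functor_maps_scheme \<Rightarrow> bool" where
  "faithful C F \<longleftrightarrow> (\<forall>M \<in> Obj C. \<forall>N \<in> Obj C. inj_on (amap F) (Hom C M N))"

lemma (in separable_functor) faithful: "faithful C F"
proof -
  obtain R where "\<forall>M \<in> Obj C. \<forall>N \<in> Obj C. \<forall>h \<in> Hom C M N. R M N (amap F h) = h"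
    using separable unfolding separating_maps_def by blast
  then show ?thesis
    unfolding faithful_def by (metis inj_on_inverseI)
qed

lemma (in covariant_functor) faithful_reflects_monomorphism:
  assumes faithful: "faithful C F" and f: "f \<in> Arr C" and mono: "monomorphism D (amap F f)"
  shows "monomorphism C f"
  unfolding monomorphism_def
proof (intro conjI ballI impI)
  show "f \<in> Arr C" by (fact f)
next
  fix A g h
  assume A: "A \<in> Obj C" and g: "g \<in> Hom C A (Dom C f)" and h: "h \<in> Hom C A (Dom C f)"
    and eq: "f \<cdot>\<^bsub>C\<^esub> g = f \<cdot>\<^bsub>C\<^esub> h"
  have f_hom: "f \<in> Hom C (Dom C f) (Cod C f)"
    using f by (simp add: Hom_def)
  have dom_Ff: "Dom D (amap F f) = omap F (Dom C f)"
    using amap_closed[OF f_hom] by (simp add: Hom_def)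
  have "amap F f \<cdot>\<^bsub>D\<^esub> amap F g = amap F f \<cdot>\<^bsub>D\<^esub> amap F h"
    using amap_Comp[OF g f_hom] amap_Comp[OF h f_hom] eq by simp
  then have "amap F g = amap F h"
    using mono omap_closed[OF A] amap_closed[OF g] amap_closed[OF h]
    unfolding monomorphism_def dom_Ff by blast
  then show "g = h"
    using faithful A C.Dom_closed[OF f] g h unfolding faithful_def by (blast dest: inj_onD)
qed

lemma (in covariant_functor) faithful_reflects_epimorphism:
  assumes faithful: "faithful C F" and f: "f \<in> Arr C" and epi: "epimorphism D (amap F f)"
  shows "epimorphism C f"
  unfolding epimorphism_def
proof (intro conjI ballI impI)
  show "f \<in> Arr C" by (fact f)
next
  fix A g h
  assume A: "A \<in> Obj C" and g: "g \<in> Hom C (Cod C f) A" and h: "h \<in> Hom C (Cod C f) A"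
    and eq: "g \<cdot>\<^bsub>C\<^esub> f = h \<cdot>\<^bsub>C\<^esub> f"
  have f_hom: "f \<in> Hom C (Dom C f) (Cod C f)"
    using f by (simp add: Hom_def)
  have cod_Ff: "Cod D (amap F f) = omap F (Cod C f)"
    using amap_closed[OF f_hom] by (simp add: Hom_def)
  have "amap F g \<cdot>\<^bsub>D\<^esub> amap F f = amap F h \<cdot>\<^bsub>D\<^esub> amap F f"
    using amap_Comp[OF f_hom g] amap_Comp[OF f_hom h] eq by simp
  then have "amap F g = amap F h"
    using epi omap_closed[OF A] amap_closed[OF g] amap_closed[OF h]
    unfolding epimorphism_def cod_Ff by blast
  then show "g = h"
    using faithful A C.Cod_closed[OF f] g h unfolding faithful_def by (blast dest: inj_onD)
qed

theorem proposition12: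
  fixes C :: "('o, 'm) category" and D :: "('p, 'n) category"
    and F :: "('o, 'm, 'p, 'n) functor_maps" and f :: 'm
  assumes "separable_functor C D F" and "f \<in> Arr C"
  shows "(monomorphism D (amap F f) \<longrightarrow> monomorphism C f) \<and>
         (epimorphism D (amap F f) \<longrightarrow> epimorphism C f)"
proof -
  interpret separable_functor C D F by (fact assms(1))
  show ?thesis
    using faithful_reflects_monomorphism[OF faithful assms(2)]
      faithful_reflects_epimorphism[OF faithful assms(2)] by blast
qed

end
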